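(* Let $\mathcal{A}=\langle S,s^0,L,\Delta\rangle$ be a probabilistic automaton and let $c\subseteq\{(s,a,\mu)\in\Delta\mid a=\tau,\ \mu\text{ is deterministic}\}$ be a probabilistically confluent set of $\tau$-transitions. Let $\phi_c:S\to S$ be a representation map for $\mathcal{A}$ under $c$. Then the automaton $\mathcal{A}/\phi_c$ and $\mathcal{A}$ are branching probabilistically bisimilar.
   Context: Distributions. $\mathrm{Distr}(S)$ is the set of probability distributions $\mu:S\to[0,1]$, $\sum_{s\in S}\mu(s)=1$, on a countable set $S$. $\mathbb{1}_t$ is the deterministic distribution with $\mathbb{1}_t(t)=1$. For an equivalence relation $R$ on $S$, $\mu\equiv_R\mu'$ means $\mu(C)=\mu'(C)$ for all $C\in S/R$, where $\mu(C)=\sum_{s\in C}\mu(s)$. Probabilistic automata. A probabilistic automaton (PA) is a tuple $\langle S,s^0,L,\Delta\rangle$ with $S$ a countable set of states, $s^0\in S$ initial, $L$ a countable set of actions containing the unobservable action $\tau$, and $\Delta\subseteq S\times L\times\mathrm{Distr}(S)$ a countable transition relation. Write $s\xrightarrow{a}\mu$ for $(s,a,\mu)\in\Delta$, and $s\xrightarrow{a}t$ for $s\xrightarrow{a}\mathbb{1}_t$. Paths and schedulers. A finite path is a sequence $\pi=s_0\,(a_1,\mu_1)\,s_1\,(a_2,\mu_2)\cdots(a_n,\mu_n)\,s_n$ ($n\ge 0$) with $s_{i}\xrightarrow{a_{i+1}}\mu_{i+1}$ and $\mu_{i+1}(s_{i+1})>0$; $\mathrm{last}(\pi)=s_n$.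 A scheduler $\mathcal{S}$ assigns to every finite path $\pi$ a probability distribution over $\{\bot\}\cup\Delta$, giving positive probability only to $\bot$ and to transitions $(s,a,\mu)$ with $s=\mathrm{last}(\pi)$ ($\bot$ means stopping). The probability of $\pi$ from $s$ is defined by $P_s^{\mathcal{S}}(s)=1$, $P_s^{\mathcal{S}}(\pi\,(a,\mu)\,t)=P_s^{\mathcal{S}}(\pi)\cdot\mathcal{S}(\pi)(\mathrm{last}(\pi),a,\mu)\cdot\mu(t)$. A maximal path of $\mathcal{S}$ from $s$ is a finite path from $s$ all of whose transitions are scheduled with positive probability after the corresponding prefix and with $\mathcal{S}(\pi)(\bot)>0$. The final state (sub)distribution is $F^{\mathcal{S}}(s)(s')=\sum_{\pi}P_s^{\mathcal{S}}(\pi)\cdot\mathcal{S}(\pi)(\bot)$, over maximal paths $\pi$ of $\mathcal{S}$ from $s$ with $\mathrm{last}(\pi)=s'$. Branching steps. For an equivalence relation $R$ on $S$, $s\Rightarrow^a_R\mu$ if either (1) $a=\tau$ and $\mu=\mathbb{1}_s$, or (2) there is a scheduler $\mathcal{S}$ with $F^{\mathcal{S}}(s)=\mu$ such that every maximal path $s\,(a_1,\mu_1)\,s_1\cdots(a_n,\mu_n)\,s_n$ of $\mathcal{S}$ from $s$ satisfies $a_n=a$ (in particular $n\ge1$) and $a_i=\tau$, $(s,s_i)\in R$ for all $1\le i<n$. Bisimulation. An equivalence relation $R\subseteq S\times S$ is a branching probabilistic bisimulation if for all $(s,t)\in R$: $s\xrightarrow{a}\mu$ implies $\exists\mu'\in\mathrm{Distr}(S)$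 with $t\Rightarrow^a_R\mu'$ and $\mu\equiv_R\mu'$. States $p,q$ are branching probabilistically bisimilar if $(p,q)\in R$ for some branching probabilistic bisimulation $R$. Two PAs are branching probabilistically bisimilar if their initial states are so in the disjoint union of the two PAs. Confluence. Let $c$ be a set of $\tau$-transitions with deterministic distributions. Write $s\to_c t$ if $(s,\tau,\mathbb{1}_t)\in c$; $s\twoheadrightarrow_c t$ if there is a finite (possibly empty) path of $\to_c$-steps from $s$ to $t$. Let $R_c=\{(s,s')\mid\exists u:\ s\twoheadrightarrow_c u\text{ and }s'\twoheadrightarrow_c u\}$. The set $c$ is probabilistically confluent if $R_c$ is an equivalence relation and, for every path $s\twoheadrightarrow_c t$ and all $a\in L$, $\mu\in\mathrm{Distr}(S)$: $s\xrightarrow{a}\mu$ implies [($\exists\nu\in\mathrm{Distr}(S)$: $t\xrightarrow{a}\nu$ and $\mu\equiv_{R_c}\nu$) or ($a=\tau$ and $\mu\equiv_{R_c}\mathbb{1}_{t}$)]. Representation maps. A function $\phi_c:S\to S$ is a representation map for $\mathcal{A}$ under $c$ if (i) for all $s,s'\in S$, $s\to_c s'$ implies $\phi_c(s)=\phi_c(s')$; and (ii) $s\twoheadrightarrow_c\phi_c(s)$ for all $s\in S$. Reduced automaton. $\mathcal{A}/\phi_c=\langle\phi_c(S),\phi_c(s^0),L,\Delta_{\phi_c}\rangle$, where $\phi_c(S)=\{\phi_c(s)\mid s\in S\}$ and $\Delta_{\phi_c}\subseteq\phi_c(S)\times L\times\mathrm{Distr}(\phi_c(S))$ contains $(s,a,\mu)$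 if and only if there is a transition $t\xrightarrow{a}\mu'$ in $\mathcal{A}$ that is not in $c$ such that $\phi_c(t)=s$ and $\mu(s')=\mu'(\{s''\in S\mid\phi_c(s'')=s'\})$ for all $s'\in\phi_c(S)$. *)

theory Defs
  imports "HOL-Probability.Probability"
begin

text \<open>
  The unobservable action is an explicit parameter \<open>\<tau>\<close> of the definitions below; two automata
  that are compared with each other share it.
\<close>

record ('s, 'l) pa =
  states :: "'s set"
  init :: "'s"
  actions :: "'l set"
  transitions :: "('s \<times> 'l \<times> 's pmf) set"

definition Distr :: "'s set \<Rightarrow> 's pmf set" where
  "Distr S = {\<mu>. set_pmf \<mu> \<subseteq> S}"

definition probabilistic_automaton :: "'l \<Rightarrow> ('s, 'l) pa \<Rightarrow> bool" where
  "probabilistic_automaton \<tau> A \<longleftrightarrow>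
     countable (states A) \<and> init A \<in> states A \<and>
     countable (actions A) \<and> \<tau> \<in> actions A \<and>
     countable (transitions A) \<and>
     transitions A \<subseteq> states A \<times> actions A \<times> Distr (states A)"

definition distr_equiv :: "'s set \<Rightarrow> ('s \<times> 's) set \<Rightarrow> 's pmf \<Rightarrow> 's pmf \<Rightarrow> bool" where
  "distr_equiv S R \<mu> \<mu>' \<longleftrightarrow>
     (\<forall>C \<in> S // R. measure_pmf.prob \<mu> C = measure_pmf.prob \<mu>' C)"


text \<open>
  The path \<open>s\<^sub>0 (a\<^sub>1, \<mu>\<^sub>1) s\<^sub>1 \<dots> (a\<^sub>n, \<mu>\<^sub>n) s\<^sub>n\<close> is represented by the pair of \<open>s\<^sub>0\<close> and the list
  \<open>[(a\<^sub>1, \<mu>\<^sub>1, s\<^sub>1), \<dots>, (a\<^sub>n, \<mu>\<^sub>n, s\<^sub>n)]\<close>.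
\<close>

type_synonym ('s, 'l) path = "'s \<times> ('l \<times> 's pmf \<times> 's) list"

fun last_state :: "('s, 'l) path \<Rightarrow> 's" where
  "last_state (s, xs) = (if xs = [] then s else snd (snd (last xs)))"

inductive_set finite_paths :: "('s, 'l) pa \<Rightarrow> ('s, 'l) path set" for A where
  start: "s \<in> states A \<Longrightarrow> (s, []) \<in> finite_paths A"
| extend: "(s, xs) \<in> finite_paths A \<Longrightarrow> (last_state (s, xs), a, \<mu>) \<in> transitions A \<Longrightarrow>
    pmf \<mu> t > 0 \<Longrightarrow> (s, xs @ [(a, \<mu>, t)]) \<in> finite_paths A"

text \<open>In the value of a scheduler, \<open>None\<close> stands for stopping.\<close>

type_synonym ('s, 'l) scheduler = "('s, 'l) path \<Rightarrow> ('s \<times> 'l \<times> 's pmf) option pmf"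

definition is_scheduler :: "('s, 'l) pa \<Rightarrow> ('s, 'l) scheduler \<Rightarrow> bool" where
  "is_scheduler A \<S> \<longleftrightarrow>
     (\<forall>\<pi> \<in> finite_paths A. set_pmf (\<S> \<pi>) \<subseteq>
        insert None (Some ` {(s, a, \<mu>). (s, a, \<mu>) \<in> transitions A \<and> s = last_state \<pi>}))"

text \<open>
  \<open>path_prob \<S> (s, xs)\<close> is the probability of the path \<open>(s, xs)\<close> from its own first state \<open>s\<close>.
\<close>

function path_prob :: "('s, 'l) scheduler \<Rightarrow> ('s, 'l) path \<Rightarrow> real" where
  "path_prob \<S> (s, []) = 1"
| "path_prob \<S> (s, xs @ [(a, \<mu>, t)]) =
     path_prob \<S> (s, xs) * pmf (\<S> (s, xs)) (Some (last_state (s, xs), a, \<mu>)) * pmf \<mu> t"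
  by (auto, metis rev_exhaust surj_pair)
termination
  by (relation "Wellfounded.measure (\<lambda>(_, _, xs). length xs)") auto

definition maximal_paths :: "('s, 'l) pa \<Rightarrow> ('s, 'l) scheduler \<Rightarrow> 's \<Rightarrow> ('s, 'l) path set" where
  "maximal_paths A \<S> s =
     {\<pi> \<in> finite_paths A. fst \<pi> = s \<and>
        (\<forall>xs a \<mu> t zs. snd \<pi> = xs @ (a, \<mu>, t) # zs \<longrightarrow>
           pmf (\<S> (s, xs)) (Some (last_state (s, xs), a, \<mu>)) > 0) \<and>
        pmf (\<S> \<pi>) None > 0}"

text \<open>
  The summands are the probabilities of pairwise exclusive outcomes (following \<open>\<pi>\<close> and then
  stopping), so that the sum always converges.
\<close>

definition final_distr :: "('s, 'l) pa \<Rightarrow> ('s, 'l) scheduler \<Rightarrow> 's \<Rightarrow> 's \<Rightarrow> real" where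
  "final_distr A \<S> s s' =
     (\<Sum>\<^sub>\<infinity>\<pi> \<in> {\<pi> \<in> maximal_paths A \<S> s. last_state \<pi> = s'}.
        path_prob \<S> \<pi> * pmf (\<S> \<pi>) None)"

definition branching_step ::
  "'l \<Rightarrow> ('s, 'l) pa \<Rightarrow> ('s \<times> 's) set \<Rightarrow> 's \<Rightarrow> 'l \<Rightarrow> 's pmf \<Rightarrow> bool" where
  "branching_step \<tau> A R s a \<mu> \<longleftrightarrow>
     (a = \<tau> \<and> \<mu> = return_pmf s) \<or>
     (\<exists>\<S>. is_scheduler A \<S> \<and>
        (\<forall>s' \<in> states A. final_distr A \<S> s s' = pmf \<mu> s') \<and>
        (\<forall>xs. (s, xs) \<in> maximal_paths A \<S> s \<longrightarrow>
           xs \<noteq> [] \<and> fst (last xs) = a \<and>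
           (\<forall>(b, \<nu>, t) \<in> set (butlast xs). b = \<tau> \<and> (s, t) \<in> R)))"

definition branching_bisimulation :: "'l \<Rightarrow> ('s, 'l) pa \<Rightarrow> ('s \<times> 's) set \<Rightarrow> bool" where
  "branching_bisimulation \<tau> A R \<longleftrightarrow>
     equiv (states A) R \<and>
     (\<forall>(s, t) \<in> R. \<forall>a \<mu>. (s, a, \<mu>) \<in> transitions A \<longrightarrow>
        (\<exists>\<mu>' \<in> Distr (states A).
           branching_step \<tau> A R t a \<mu>' \<and> distr_equiv (states A) R \<mu> \<mu>'))"

definition branching_bisimilar_states :: "'l \<Rightarrow> ('s, 'l) pa \<Rightarrow> 's \<Rightarrow> 's \<Rightarrow> bool" where
  "branching_bisimilar_states \<tau> A p q \<longleftrightarrow>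
     (\<exists>R. branching_bisimulation \<tau> A R \<and> (p, q) \<in> R)"

text \<open>
  The initial state of a disjoint union is immaterial, as bisimulations do not refer to it; that of
  the first component is taken.
\<close>

definition disjoint_union :: "('s, 'l) pa \<Rightarrow> ('t, 'l) pa \<Rightarrow> ('s + 't, 'l) pa" where
  "disjoint_union A B =
     \<lparr> states = states A <+> states B,
       init = Inl (init A),
       actions = actions A \<union> actions B,
       transitions =
         {(Inl s, a, map_pmf Inl \<mu>) |s a \<mu>. (s, a, \<mu>) \<in> transitions A} \<union>
         {(Inr t, a, map_pmf Inr \<mu>) |t a \<mu>. (t, a, \<mu>) \<in> transitions B} \<rparr>"

definition branching_bisimilar :: "'l \<Rightarrow> ('s, 'l) pa \<Rightarrow> ('t, 'l) pa \<Rightarrow> bool" where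
  "branching_bisimilar \<tau> A B \<longleftrightarrow>
     branching_bisimilar_states \<tau> (disjoint_union A B) (Inl (init A)) (Inr (init B))"


definition deterministic_tau_transitions ::
  "'l \<Rightarrow> ('s, 'l) pa \<Rightarrow> ('s \<times> 'l \<times> 's pmf) set" where
  "deterministic_tau_transitions \<tau> A =
     {(s, a, \<mu>) \<in> transitions A. a = \<tau> \<and> (\<exists>t. \<mu> = return_pmf t)}"

definition c_step :: "'l \<Rightarrow> ('s \<times> 'l \<times> 's pmf) set \<Rightarrow> ('s \<times> 's) set" where
  "c_step \<tau> c = {(s, t). (s, \<tau>, return_pmf t) \<in> c}"

text \<open>
  The reflexive closure in \<open>(c_step \<tau> c)\<^sup>*\<close> is taken on the whole type, hence the explicit
  restrictions to the states of \<open>A\<close>.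
\<close>

definition R_c :: "'l \<Rightarrow> ('s, 'l) pa \<Rightarrow> ('s \<times> 'l \<times> 's pmf) set \<Rightarrow> ('s \<times> 's) set" where
  "R_c \<tau> A c =
     {(s, s'). s \<in> states A \<and> s' \<in> states A \<and>
        (\<exists>u. (s, u) \<in> (c_step \<tau> c)\<^sup>* \<and> (s', u) \<in> (c_step \<tau> c)\<^sup>*)}"

definition probabilistically_confluent ::
  "'l \<Rightarrow> ('s, 'l) pa \<Rightarrow> ('s \<times> 'l \<times> 's pmf) set \<Rightarrow> bool" where
  "probabilistically_confluent \<tau> A c \<longleftrightarrow>
     equiv (states A) (R_c \<tau> A c) \<and>
     (\<forall>s \<in> states A. \<forall>t a. \<forall>\<mu> \<in> Distr (states A).
        (s, t) \<in> (c_step \<tau> c)\<^sup>* \<longrightarrow> (s, a, \<mu>) \<in> transitions A \<longrightarrow>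
          (\<exists>\<nu> \<in> Distr (states A).
             (t, a, \<nu>) \<in> transitions A \<and> distr_equiv (states A) (R_c \<tau> A c) \<mu> \<nu>) \<or>
          (a = \<tau> \<and> distr_equiv (states A) (R_c \<tau> A c) \<mu> (return_pmf t)))"

definition representation_map ::
  "'l \<Rightarrow> ('s, 'l) pa \<Rightarrow> ('s \<times> 'l \<times> 's pmf) set \<Rightarrow> ('s \<Rightarrow> 's) \<Rightarrow> bool" where
  "representation_map \<tau> A c \<phi> \<longleftrightarrow>
     \<phi> \<in> states A \<rightarrow> states A \<and>
     (\<forall>s \<in> states A. \<forall>s' \<in> states A. (s, s') \<in> c_step \<tau> c \<longrightarrow> \<phi> s = \<phi> s') \<and>
     (\<forall>s \<in> states A. (s, \<phi> s) \<in> (c_step \<tau> c)\<^sup>*)"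

definition reduced_pa ::
  "('s, 'l) pa \<Rightarrow> ('s \<times> 'l \<times> 's pmf) set \<Rightarrow> ('s \<Rightarrow> 's) \<Rightarrow> ('s, 'l) pa" where
  "reduced_pa A c \<phi> =
     \<lparr> states = \<phi> ` states A,
       init = \<phi> (init A),
       actions = actions A,
       transitions =
         {(s, a, \<mu>) \<in> \<phi> ` states A \<times> actions A \<times> Distr (\<phi> ` states A).
            \<exists>t \<mu>'. (t, a, \<mu>') \<in> transitions A - c \<and> \<phi> t = s \<and>
              (\<forall>s' \<in> \<phi> ` states A.
                 pmf \<mu> s' = measure_pmf.prob \<mu>' {s'' \<in> states A. \<phi> s'' = s'})} \<rparr>"

end

theory Submission
  imports Defs
begin

text \<open>
  Confluence makes \<open>\<phi> s\<close> a canonical representative of the class of \<open>s\<close> modulo \<open>R_c\<close>. On the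
  disjoint union take the kernel of the map that sends every state to its representative. If
  \<open>s \<rightarrow> \<mu>\<close> then, by confluence along the \<open>c\<close>-path from \<open>s\<close> to \<open>\<phi> s\<close>, either \<open>\<phi> s\<close> has a matching
  transition, or the step is an internal one that stays in the class. In the former case a state
  \<open>t\<close> of the original automaton in the same class answers by walking along \<open>c\<close> to \<open>\<phi> t = \<phi> s\<close> and
  then taking the matching transition; the state \<open>\<phi> s\<close> of the reduced automaton has the quotient of
  that transition, unless it lies in \<open>c\<close> and may be skipped.
\<close>

section \<open>Distributions modulo the kernel of a map\<close>

text \<open>Both \<open>R_c\<close> and the bisimulation will be kernels; for these, equivalence of
  distributions is equality of image distributions.\<close>

definition kernel_on :: "'s set \<Rightarrow> ('s \<Rightarrow> 't) \<Rightarrow> ('s \<times> 's) set" where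
  "kernel_on S f = {(x, y). x \<in> S \<and> y \<in> S \<and> f x = f y}"

lemma equiv_kernel_on: "equiv S (kernel_on S f)"
  by (rule equivI) (auto simp: kernel_on_def refl_on_def sym_def trans_def)

text \<open>Cutting the preimage down to \<open>S\<close> loses no mass, as \<open>\<mu>\<close> is
  supported there. The right-hand side has the form used in \<open>reduced_pa\<close>.\<close>

lemma pmf_map_eq_prob_fibre:
  assumes "\<mu> \<in> Distr S"
  shows "pmf (map_pmf f \<mu>) y = measure_pmf.prob \<mu> {x \<in> S. f x = y}"
proof -
  have "pmf (map_pmf f \<mu>) y = measure_pmf.prob \<mu> (f -` {y})"
    by (rule pmf_map)
  also have "\<dots> = measure_pmf.prob \<mu> {x \<in> S. f x = y}"
    using assms by (intro measure_pmf.finite_measure_eq_AE) (auto simp: AE_measure_pmf_iff Distr_def)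
  finally show ?thesis .
qed

text \<open>The classes are the non-empty fibres of \<open>f\<close> on \<open>S\<close>, and their
  masses are the point masses of the image distributions.\<close>

lemma distr_equiv_kernel_on_iff:
  assumes "\<mu> \<in> Distr S" "\<nu> \<in> Distr S"
  shows "distr_equiv S (kernel_on S f) \<mu> \<nu> \<longleftrightarrow> map_pmf f \<mu> = map_pmf f \<nu>"
proof
  assume eq: "map_pmf f \<mu> = map_pmf f \<nu>"
  show "distr_equiv S (kernel_on S f) \<mu> \<nu>"
    unfolding distr_equiv_def
  proof
    fix C assume "C \<in> S // kernel_on S f"
    then obtain x where "x \<in> S" and C: "C = kernel_on S f `` {x}"
      by (auto elim: quotientE)
    then have "C = {y \<in> S. f y = f x}"
      by (auto simp: kernel_on_def)
    with eq show "measure_pmf.prob \<mu> C = measure_pmf.prob \<nu> C"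
      by (simp only: assms[THEN pmf_map_eq_prob_fibre, symmetric])
  qed
next
  assume R: "distr_equiv S (kernel_on S f) \<mu> \<nu>"
  show "map_pmf f \<mu> = map_pmf f \<nu>"
  proof (rule pmf_eqI)
    fix y
    have "measure_pmf.prob \<mu> {x \<in> S. f x = y} = measure_pmf.prob \<nu> {x \<in> S. f x = y}"
    proof (cases "y \<in> f ` S")
      case True
      then obtain x where "x \<in> S" "y = f x" by auto
      then have "{x \<in> S. f x = y} = kernel_on S f `` {x}"
        by (auto simp: kernel_on_def)
      then show ?thesis
        using R \<open>x \<in> S\<close> by (auto simp: distr_equiv_def quotientI)
    next
      case False
      then have "{x \<in> S. f x = y} = {}" by auto
      then show ?thesis by (simp only: measure_empty)
    qed
    then show "pmf (map_pmf f \<mu>) y = pmf (map_pmf f \<nu>) y"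
      using assms by (simp add: pmf_map_eq_prob_fibre)
  qed
qed

section \<open>Branching steps along deterministic paths\<close>

text \<open>The states come as a function on naturals because \<open>relpow_fun_conv\<close> yields
  paths in that form. The start \<open>u 0\<close> is no entry of the list, as in
  \<open>path\<close>.\<close>

definition chain :: "'l \<Rightarrow> (nat \<Rightarrow> 's) \<Rightarrow> nat \<Rightarrow> ('l \<times> 's pmf \<times> 's) list" where
  "chain \<tau> u k = map (\<lambda>i. (\<tau>, return_pmf (u (Suc i)), u (Suc i))) [0..<k]"

lemma chain_0 [simp]: "chain \<tau> u 0 = []"
  and chain_Suc: "chain \<tau> u (Suc k) = chain \<tau> u k @ [(\<tau>, return_pmf (u (Suc k)), u (Suc k))]"
  and length_chain [simp]: "length (chain \<tau> u k) = k"
  and nth_chain: "i < k \<Longrightarrow> chain \<tau> u k ! i = (\<tau>, return_pmf (u (Suc i)), u (Suc i))"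
  by (simp_all add: chain_def)

lemma last_state_chain [simp]: "last_state (u 0, chain \<tau> u k) = u k"
  by (cases k) (simp_all add: chain_Suc)

lemma finite_paths_chain:
  assumes "u 0 \<in> states A" "\<And>i. i < n \<Longrightarrow> (u i, \<tau>, return_pmf (u (Suc i))) \<in> transitions A"
    and "k \<le> n"
  shows "(u 0, chain \<tau> u k) \<in> finite_paths A"
  using assms(3)
proof (induction k)
  case 0
  then show ?case using assms(1) by (simp add: finite_paths.start)
next
  case (Suc k)
  then show ?case
    unfolding chain_Suc by (intro finite_paths.extend) (auto simp: assms(2) simp del: last_state.simps)
qed

text \<open>Used to force successors: \<open>return_pmf\<close> has positive mass at one point
  only.\<close>

lemma finite_paths_pmf_pos:
  assumes "(s, xs) \<in> finite_paths A" "(a, \<mu>, t) \<in> set xs"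
  shows "pmf \<mu> t > 0"
  using assms by (induction s xs rule: finite_paths.induct) auto

text \<open>Every choice is a point mass. Stopping is the default off the chain, which includes all
  paths with more than \<open>n\<close> transitions, hence those that have just taken
  \<open>(a, \<nu>)\<close>.\<close>

definition chain_scheduler ::
  "'l \<Rightarrow> (nat \<Rightarrow> 's) \<Rightarrow> nat \<Rightarrow> 'l \<Rightarrow> 's pmf \<Rightarrow> ('s, 'l) scheduler" where
  "chain_scheduler \<tau> u n a \<nu> \<pi> =
     (let k = length (snd \<pi>) in
      return_pmf (if k \<le> n \<and> \<pi> = (u 0, chain \<tau> u k)
        then Some (if k < n then (u k, \<tau>, return_pmf (u (Suc k))) else (u n, a, \<nu>)) else None))"

lemma chain_scheduler_chain:
  "k < n \<Longrightarrow> chain_scheduler \<tau> u n a \<nu> (u 0, chain \<tau> u k) =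
     return_pmf (Some (u k, \<tau>, return_pmf (u (Suc k))))"
  "chain_scheduler \<tau> u n a \<nu> (u 0, chain \<tau> u n) = return_pmf (Some (u n, a, \<nu>))"
  "n < length xs \<Longrightarrow> chain_scheduler \<tau> u n a \<nu> (s, xs) = return_pmf None"
  by (simp_all add: chain_scheduler_def)

text \<open>Along the chain both the choices and the successors are certain, so every factor is
  1.\<close>

lemma path_prob_chain:
  "k \<le> n \<Longrightarrow> path_prob (chain_scheduler \<tau> u n a \<nu>) (u 0, chain \<tau> u k) = 1"
  by (induction k) (simp_all add: chain_Suc chain_scheduler_chain del: last_state.simps)

lemma is_scheduler_chain_scheduler:
  fixes A :: "('s, 'l) pa"
  assumes "\<And>i. i < n \<Longrightarrow> (u i, \<tau>, return_pmf (u (Suc i))) \<in> transitions A"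
    and "(u n, a, \<nu>) \<in> transitions A"
  shows "is_scheduler A (chain_scheduler \<tau> u n a \<nu>)"
  unfolding is_scheduler_def
proof
  fix \<pi> :: "('s, 'l) path"
  let ?k = "length (snd \<pi>)"
  show "set_pmf (chain_scheduler \<tau> u n a \<nu> \<pi>) \<subseteq>
      insert None (Some ` {(s, a, \<mu>). (s, a, \<mu>) \<in> transitions A \<and> s = last_state \<pi>})"
  proof (cases "?k \<le> n \<and> \<pi> = (u 0, chain \<tau> u ?k)")
    case True
    then have "last_state \<pi> = u ?k" by (metis last_state_chain)
    then show ?thesis
      using True assms by (cases "?k = n") (auto simp: chain_scheduler_def Let_def)
  next
    case False
    then show ?thesis by (auto simp: chain_scheduler_def Let_def)
  qed
qed

text \<open>The only randomness is the successor in the final transition, and on the chain the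
  scheduler cannot stop earlier.\<close>

lemma maximal_paths_chain_scheduler:
  assumes "u 0 \<in> states A"
    and tr: "\<And>i. i < n \<Longrightarrow> (u i, \<tau>, return_pmf (u (Suc i))) \<in> transitions A"
    and "(u n, a, \<nu>) \<in> transitions A"
  shows "maximal_paths A (chain_scheduler \<tau> u n a \<nu>) (u 0) =
    (\<lambda>t. (u 0, chain \<tau> u n @ [(a, \<nu>, t)])) ` set_pmf \<nu>"
    (is "?M = ?P")
proof
  show "?M \<subseteq> ?P"
  proof
    fix \<pi> assume "\<pi> \<in> ?M"
    then obtain xs where \<pi>: "\<pi> = (u 0, xs)" and fin: "(u 0, xs) \<in> finite_paths A"
      and sched: "\<And>ys b \<mu> t zs. xs = ys @ (b, \<mu>, t) # zs \<Longrightarrow>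
        pmf (chain_scheduler \<tau> u n a \<nu> (u 0, ys)) (Some (last_state (u 0, ys), b, \<mu>)) > 0"
      and stop: "pmf (chain_scheduler \<tau> u n a \<nu> (u 0, xs)) None > 0"
      unfolding maximal_paths_def by (cases \<pi>) auto
    \<comment> \<open>Choices are point masses, so positive probability identifies the edge at
      position \<open>k\<close> with the choice made after the first \<open>k\<close> edges.\<close>
    have split: "\<exists>b \<mu> t. xs = take k xs @ (b, \<mu>, t) # drop (Suc k) xs \<and> pmf \<mu> t > 0 \<and>
        chain_scheduler \<tau> u n a \<nu> (u 0, take k xs) \<noteq> return_pmf None \<and>
        (\<forall>v. chain_scheduler \<tau> u n a \<nu> (u 0, take k xs) = return_pmf (Some v) \<longrightarrow>
          v = (last_state (u 0, take k xs), b, \<mu>))" if "k < length xs" for k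
    proof -
      obtain b \<mu> t where x: "xs ! k = (b, \<mu>, t)" by (metis surj_pair)
      then have xs: "xs = take k xs @ (b, \<mu>, t) # drop (Suc k) xs"
        using id_take_nth_drop[OF that] by simp
      have "pmf \<mu> t > 0"
        using finite_paths_pmf_pos[OF fin] x that by (metis nth_mem)
      moreover note sched[OF xs]
      ultimately show ?thesis
        using xs by (auto simp: indicator_def simp del: last_state.simps split: if_splits intro!: exI)
    qed
    \<comment> \<open>The scheduler fixes label and distribution of each edge; positivity of
      \<open>pmf \<mu> t\<close> then fixes its target.\<close>
    have pre: "take k xs = chain \<tau> u k" if "k \<le> n" "k \<le> length xs" for k
      using that
    proof (induction k)
      case (Suc k)
      then have IH: "take k xs = chain \<tau> u k" by simp
      obtain b \<mu> t where xs: "xs = take k xs @ (b, \<mu>, t) # drop (Suc k) xs" and "pmf \<mu> t > 0"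
        and "(b, \<mu>) = (\<tau>, return_pmf (u (Suc k)))"
        using split[of k] Suc.prems
        by (auto simp: IH chain_scheduler_chain simp del: last_state.simps)
      then have "(b, \<mu>, t) = (\<tau>, return_pmf (u (Suc k)), u (Suc k))"
        by (auto simp: indicator_def split: if_splits)
      moreover have "xs ! k = (b, \<mu>, t)"
        using xs Suc.prems
        by (metis Suc_le_lessD length_take min.absorb4 nth_append_length)
      ultimately show ?case
        using Suc.prems IH by (simp add: take_Suc_conv_app_nth chain_Suc)
    qed simp
    \<comment> \<open>Otherwise \<open>xs\<close> is an initial piece of the chain, where stopping
      has probability 0.\<close>
    have n: "n < length xs"
    proof (rule ccontr)
      assume "\<not> n < length xs"
      then have le: "length xs \<le> n" by simp
      then have "xs = chain \<tau> u (length xs)"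
        using pre[of "length xs"] by simp
      then have "chain_scheduler \<tau> u n a \<nu> (u 0, xs) \<noteq> return_pmf None"
        using le unfolding chain_scheduler_def by (auto simp: Let_def)
      with stop le \<open>xs = chain \<tau> u (length xs)\<close> show False
        by (auto simp: chain_scheduler_def Let_def)
    qed
    obtain b \<mu> t where xs: "xs = chain \<tau> u n @ (b, \<mu>, t) # drop (Suc n) xs" and "pmf \<mu> t > 0"
      and "(b, \<mu>) = (a, \<nu>)"
      using split[OF n] pre[of n] n by (auto simp: chain_scheduler_chain simp del: last_state.simps)
    \<comment> \<open>After \<open>Suc n\<close> edges the scheduler stops, so no further edge can
      be scheduled.\<close>
    moreover have "length xs \<le> Suc n"
    proof (rule ccontr)
      assume "\<not> length xs \<le> Suc n"
      then show False
        using split[of "Suc n"] by (auto simp: chain_scheduler_chain)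
    qed
    ultimately show "\<pi> \<in> ?P"
      using \<pi> by (auto simp: set_pmf_iff)
  qed
next
  show "?P \<subseteq> ?M"
  proof
    fix \<pi> assume "\<pi> \<in> ?P"
    then obtain t where \<pi>: "\<pi> = (u 0, chain \<tau> u n @ [(a, \<nu>, t)])" and t: "t \<in> set_pmf \<nu>"
      by auto
    have "\<pi> \<in> finite_paths A"
      unfolding \<pi> using assms t
      by (intro finite_paths.extend finite_paths_chain[of u A n])
        (auto simp: pmf_positive simp del: last_state.simps)
    moreover have "pmf (chain_scheduler \<tau> u n a \<nu> (u 0, ys)) (Some (last_state (u 0, ys), b, \<mu>)) > 0"
      if eq: "chain \<tau> u n @ [(a, \<nu>, t)] = ys @ (b, \<mu>, t') # zs" for ys b \<mu> t' zs
    proof -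
      \<comment> \<open>The position decides which choice is due: a chain edge for
        \<open>k < n\<close>, the final transition for \<open>k = n\<close>.\<close>
      define k where "k = length ys"
      have "k \<le> n"
        using arg_cong[OF eq, of length] by (simp add: k_def)
      have "ys = take k (chain \<tau> u n @ [(a, \<nu>, t)])"
        unfolding eq by (simp add: k_def)
      also have "\<dots> = chain \<tau> u k"
        using \<open>k \<le> n\<close> by (simp add: chain_def take_map)
      finally have ys: "ys = chain \<tau> u k" .
      have "(b, \<mu>, t') = (chain \<tau> u n @ [(a, \<nu>, t)]) ! k"
        unfolding eq by (simp add: k_def)
      then show ?thesis
        unfolding ys using \<open>k \<le> n\<close>
        by (cases "k = n")
          (auto simp: chain_scheduler_chain nth_append nth_chain simp del: last_state.simps)
    qed
    ultimately show "\<pi> \<in> ?M"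
      unfolding maximal_paths_def \<pi> by (auto simp: chain_scheduler_chain simp del: last_state.simps)
  qed
qed

text \<open>Each state in the support of \<open>\<nu>\<close> ends exactly one maximal path, so the
  final distribution is \<open>\<nu>\<close>. The condition on \<open>R\<close> covers
  \<open>u 1\<close> to \<open>u n\<close>, the states before the final transition;
  \<open>n = 0\<close> gives a single ordinary transition.\<close>

lemma branching_step_chain:
  assumes "u 0 \<in> states A"
    and tr: "\<And>i. i < n \<Longrightarrow> (u i, \<tau>, return_pmf (u (Suc i))) \<in> transitions A"
    and R: "\<And>i. i < n \<Longrightarrow> (u 0, u (Suc i)) \<in> R"
    and last: "(u n, a, \<nu>) \<in> transitions A"
  shows "branching_step \<tau> A R (u 0) a \<nu>"
proof -
  let ?S = "chain_scheduler \<tau> u n a \<nu>"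
  have max: "maximal_paths A ?S (u 0) = (\<lambda>t. (u 0, chain \<tau> u n @ [(a, \<nu>, t)])) ` set_pmf \<nu>"
    using assms(1) tr last by (rule maximal_paths_chain_scheduler)
  have "final_distr A ?S (u 0) s = pmf \<nu> s" for s
  proof (cases "s \<in> set_pmf \<nu>")
    case True
    then have "{\<pi> \<in> maximal_paths A ?S (u 0). last_state \<pi> = s} = {(u 0, chain \<tau> u n @ [(a, \<nu>, s)])}"
      unfolding max by auto
    then show ?thesis
      by (simp add: final_distr_def path_prob_chain chain_scheduler_chain del: last_state.simps)
  next
    case False
    then have "{\<pi> \<in> maximal_paths A ?S (u 0). last_state \<pi> = s} = {}"
      unfolding max by auto
    then show ?thesis
      using False by (simp only: final_distr_def) (simp add: set_pmf_iff)
  qed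
  moreover have "is_scheduler A ?S"
    using tr last by (rule is_scheduler_chain_scheduler)
  ultimately show ?thesis
    unfolding branching_step_def using R
    by (intro disjI2 exI[of _ ?S]) (auto simp: max chain_def)
qed

section \<open>The quotient under a representation map\<close>

lemma states_disjoint_union [simp]: "states (disjoint_union A B) = states A <+> states B"
  by (simp add: disjoint_union_def)

lemma transitions_disjoint_union:
  "transitions (disjoint_union A B) =
     {(Inl s, a, map_pmf Inl \<mu>) |s a \<mu>. (s, a, \<mu>) \<in> transitions A} \<union>
     {(Inr t, a, map_pmf Inr \<mu>) |t a \<mu>. (t, a, \<mu>) \<in> transitions B}"
  by (simp add: disjoint_union_def)

text \<open>Steps of \<open>c\<close> are transitions of \<open>A\<close>, so they stay inside its
  states, and a representation map is constant along them.\<close>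

lemma rtrancl_c_step:
  assumes "probabilistic_automaton \<tau> A" "c \<subseteq> deterministic_tau_transitions \<tau> A"
    and "representation_map \<tau> A c \<phi>" "(s, t) \<in> (c_step \<tau> c)\<^sup>*" "s \<in> states A"
  shows "t \<in> states A \<and> \<phi> t = \<phi> s"
  using assms(4)
proof (induction rule: rtrancl_induct)
  case base
  then show ?case using assms(5) by simp
next
  case (step y z)
  then have "(y, \<tau>, return_pmf z) \<in> transitions A"
    using assms(2) by (auto simp: c_step_def deterministic_tau_transitions_def)
  then have "z \<in> states A"
    using assms(1) by (auto simp: probabilistic_automaton_def Distr_def)
  then show ?case
    using step assms(3) by (auto simp: representation_map_def)
qed

text \<open>States with equal representatives meet at that representative; conversely
  \<open>\<phi>\<close> is constant on both paths to a meeting point.\<close>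

lemma R_c_eq_kernel_on:
  assumes "probabilistic_automaton \<tau> A" "c \<subseteq> deterministic_tau_transitions \<tau> A"
    and "representation_map \<tau> A c \<phi>"
  shows "R_c \<tau> A c = kernel_on (states A) \<phi>"
proof -
  have "(s, \<phi> s) \<in> (c_step \<tau> c)\<^sup>*" if "s \<in> states A" for s
    using that assms(3) by (auto simp: representation_map_def)
  then show ?thesis
    unfolding R_c_def kernel_on_def using rtrancl_c_step[OF assms] by (safe; metis)
qed

text \<open>The prescribed values on the representatives, together with the support condition,
  determine \<open>\<mu>\<close> as the image of \<open>\<mu>'\<close>.\<close>

lemma transitions_reduced_pa_iff:
  assumes "probabilistic_automaton \<tau> A" "\<phi> \<in> states A \<rightarrow> states A"
  shows "(p, a, \<mu>) \<in> transitions (reduced_pa A c \<phi>) \<longleftrightarrow>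
    (\<exists>t \<mu>'. (t, a, \<mu>') \<in> transitions A - c \<and> \<phi> t = p \<and> \<mu> = map_pmf \<phi> \<mu>')"
    (is "?L \<longleftrightarrow> ?R")
proof
  assume ?L
  then obtain t \<mu>' where tr: "(t, a, \<mu>') \<in> transitions A - c" "\<phi> t = p"
    and supp: "\<mu> \<in> Distr (\<phi> ` states A)"
    and pmf: "\<forall>s \<in> \<phi> ` states A. pmf \<mu> s = measure_pmf.prob \<mu>' {x \<in> states A. \<phi> x = s}"
    by (auto simp: reduced_pa_def)
  have \<mu>': "\<mu>' \<in> Distr (states A)"
    using tr assms(1) by (auto simp: probabilistic_automaton_def)
  have "\<mu> = map_pmf \<phi> \<mu>'"
  proof (rule pmf_eqI)
    fix s show "pmf \<mu> s = pmf (map_pmf \<phi> \<mu>') s"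
    proof (cases "s \<in> \<phi> ` states A")
      case True
      then show ?thesis using pmf by (simp only: pmf_map_eq_prob_fibre[OF \<mu>'])
    next
      case False
      then have "s \<notin> set_pmf \<mu>" "s \<notin> set_pmf (map_pmf \<phi> \<mu>')"
        using supp \<mu>' by (auto simp: Distr_def)
      then show ?thesis by (metis set_pmf_iff)
    qed
  qed
  then show ?R using tr by blast
next
  assume ?R
  then obtain t \<mu>' where tr: "(t, a, \<mu>') \<in> transitions A - c" "\<phi> t = p" "\<mu> = map_pmf \<phi> \<mu>'"
    by blast
  moreover from tr have "t \<in> states A" "a \<in> actions A" and \<mu>': "\<mu>' \<in> Distr (states A)"
    using assms(1) by (auto simp: probabilistic_automaton_def)
  moreover from \<mu>' have "map_pmf \<phi> \<mu>' \<in> Distr (\<phi> ` states A)"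
    by (auto simp: Distr_def)
  ultimately show ?L
    by (auto simp: reduced_pa_def pmf_map_eq_prob_fibre[OF \<mu>'])
qed

text \<open>This is confluence along the path from \<open>s\<close> to \<open>\<phi> s\<close>, with
  \<open>R_c\<close> read as the kernel of \<open>\<phi>\<close>; idempotence of
  \<open>\<phi>\<close> simplifies the second case.\<close>

lemma confluent_representative_transition:
  assumes pa: "probabilistic_automaton \<tau> A" and c: "c \<subseteq> deterministic_tau_transitions \<tau> A"
    and conf: "probabilistically_confluent \<tau> A c" and rep: "representation_map \<tau> A c \<phi>"
    and tr: "(s, a, \<mu>) \<in> transitions A"
  obtains (step) \<nu> where "(\<phi> s, a, \<nu>) \<in> transitions A" "map_pmf \<phi> \<mu> = map_pmf \<phi> \<nu>"
  | (stay) "a = \<tau>" "map_pmf \<phi> \<mu> = return_pmf (\<phi> s)"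
proof -
  have s: "s \<in> states A" and \<mu>: "\<mu> \<in> Distr (states A)"
    using pa tr by (auto simp: probabilistic_automaton_def)
  have path: "(s, \<phi> s) \<in> (c_step \<tau> c)\<^sup>*"
    using rep s by (auto simp: representation_map_def)
  have \<phi>s: "\<phi> s \<in> states A" "\<phi> (\<phi> s) = \<phi> s"
    using rtrancl_c_step[OF pa c rep path s] by auto
  have "(\<exists>\<nu> \<in> Distr (states A). (\<phi> s, a, \<nu>) \<in> transitions A \<and>
       distr_equiv (states A) (R_c \<tau> A c) \<mu> \<nu>) \<or>
     (a = \<tau> \<and> distr_equiv (states A) (R_c \<tau> A c) \<mu> (return_pmf (\<phi> s)))"
    using conf s \<mu> path tr by (auto simp: probabilistically_confluent_def)
  moreover have "return_pmf (\<phi> s) \<in> Distr (states A)"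
    using \<phi>s by (simp add: Distr_def)
  ultimately show thesis
    using that \<mu> \<phi>s(2)
    unfolding R_c_eq_kernel_on[OF pa c rep]
    by (auto simp: distr_equiv_kernel_on_iff)
qed

section \<open>The bisimulation on the disjoint union\<close>

theorem theorem26:
  fixes \<tau> :: 'l
    and A :: "('s, 'l) pa"
    and c :: "('s \<times> 'l \<times> 's pmf) set"
    and \<phi> :: "'s \<Rightarrow> 's"
  assumes "probabilistic_automaton \<tau> A"
    and "c \<subseteq> deterministic_tau_transitions \<tau> A"
    and "probabilistically_confluent \<tau> A c"
    and "representation_map \<tau> A c \<phi>"
  shows "branching_bisimilar \<tau> (reduced_pa A c \<phi>) A"
proof -
  let ?B = "reduced_pa A c \<phi>"
  define D where "D = disjoint_union ?B A"
  \<comment> \<open>On the reduced summand \<open>\<phi>\<close> acts as the identity, so one map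
    serves both sides.\<close>
  define f where "f = case_sum \<phi> \<phi>"
  define R where "R = kernel_on (states D) f"
  have \<phi>: "\<phi> \<in> states A \<rightarrow> states A"
    and path: "\<And>s. s \<in> states A \<Longrightarrow> (s, \<phi> s) \<in> (c_step \<tau> c)\<^sup>*"
    using assms(4) by (auto simp: representation_map_def)
  have idem: "\<phi> (\<phi> s) = \<phi> s" if "s \<in> states A" for s
    using rtrancl_c_step[OF assms(1,2,4) path[OF that] that] by simp
  have f [simp]: "f (Inl s) = \<phi> s" "f (Inr s) = \<phi> s" for s
    by (simp_all add: f_def)
  have map_f [simp]: "map_pmf f (map_pmf Inl \<mu>) = map_pmf \<phi> \<mu>"
    "map_pmf f (map_pmf Inr \<mu>) = map_pmf \<phi> \<mu>" for \<mu>
    by (simp_all add: pmf.map_comp o_def)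
  have A_D: "s \<in> states A \<and> a \<in> actions A \<and> \<mu> \<in> Distr (states A)"
    if "(s, a, \<mu>) \<in> transitions A" for s a \<mu>
    using that assms(1) by (auto simp: probabilistic_automaton_def)
  have states_B: "states ?B = \<phi> ` states A"
    by (simp add: reduced_pa_def)
  have states_D: "states D = \<phi> ` states A <+> states A"
    by (simp add: D_def states_B)
  have map_idem: "map_pmf \<phi> (map_pmf \<phi> \<mu>) = map_pmf \<phi> \<mu>" if "\<mu> \<in> Distr (states A)" for \<mu>
    unfolding pmf.map_comp using that by (intro map_pmf_cong) (auto simp: Distr_def idem)
  \<comment> \<open>Transitions of either summand are traced back to \<open>A\<close> with the same
    images, so that confluence applies uniformly to both.\<close>
  have D_transition: "M \<in> Distr (states D) \<and>
      (\<exists>s \<mu>. (s, a, \<mu>) \<in> transitions A \<and> f x = \<phi> s \<and> map_pmf f M = map_pmf \<phi> \<mu>)"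
    if tr: "(x, a, M) \<in> transitions D" for x a M
  proof -
    consider (reduced) p \<mu> where "x = Inl p" "M = map_pmf Inl \<mu>" "(p, a, \<mu>) \<in> transitions ?B"
      | (original) s \<mu> where "x = Inr s" "M = map_pmf Inr \<mu>" "(s, a, \<mu>) \<in> transitions A"
      using tr unfolding D_def transitions_disjoint_union by blast
    then show ?thesis
    proof cases
      case (reduced p \<mu>)
      then obtain t \<mu>' where t: "(t, a, \<mu>') \<in> transitions A" "\<phi> t = p" "\<mu> = map_pmf \<phi> \<mu>'"
        by (auto simp: transitions_reduced_pa_iff[OF assms(1) \<phi>])
      moreover have "M \<in> Distr (states D)"
        using reduced t(3) A_D[OF t(1)] by (auto simp: states_D Distr_def)
      ultimately show ?thesis
        using reduced A_D[OF t(1)]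
        by (intro conjI exI[of _ t] exI[of _ \<mu>']) (auto simp: idem map_idem simp del: pmf.map_comp)
    next
      case (original s \<mu>)
      then show ?thesis
        using A_D[of s a \<mu>]
        by (intro conjI exI[of _ s] exI[of _ \<mu>]) (auto simp: states_D Distr_def)
    qed
  qed
  have "\<exists>M' \<in> Distr (states D). branching_step \<tau> D R y a M' \<and> distr_equiv (states D) R M M'"
    if xy: "(x, y) \<in> R" and tr: "(x, a, M) \<in> transitions D" for x y a M
  proof -
    obtain s \<mu> where M: "M \<in> Distr (states D)" "(s, a, \<mu>) \<in> transitions A" "f x = \<phi> s"
      "map_pmf f M = map_pmf \<phi> \<mu>"
      using D_transition[OF tr] by blast
    have y: "y \<in> states D" "f y = \<phi> s"
      using xy M(3) by (auto simp: R_def kernel_on_def)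
    have answer: ?thesis
      if "branching_step \<tau> D R y a M'" "M' \<in> Distr (states D)" "map_pmf f M' = map_pmf \<phi> \<mu>" for M'
      using that M(1,4) by (auto simp: R_def distr_equiv_kernel_on_iff)
    \<comment> \<open>An internal move within the class is answered by staying at \<open>y\<close>,
      the first clause of \<open>branching_step\<close>.\<close>
    have skip: ?thesis if "a = \<tau>" "map_pmf \<phi> \<mu> = return_pmf (\<phi> s)"
      using that y by (intro answer[of "return_pmf y"]) (auto simp: branching_step_def Distr_def)
    from assms M(2) show ?thesis
    proof (cases rule: confluent_representative_transition)
      case stay
      then show ?thesis by (rule skip)
    next
      case (step \<nu>)
      show ?thesis
      proof (cases y)
        case (Inl p)
        then have p: "p = \<phi> s" using y idem by (auto simp: states_D)
        show ?thesis
        \<comment> \<open>Transitions in \<open>c\<close> do not generate reduced ones, but they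
          stay in their class and can be skipped.\<close>
        proof (cases "(\<phi> s, a, \<nu>) \<in> c")
          case True
          then obtain t where t: "a = \<tau>" "\<nu> = return_pmf t"
            using assms(2) by (auto simp: deterministic_tau_transitions_def)
          then have "(\<phi> s, t) \<in> (c_step \<tau> c)\<^sup>*"
            using True by (auto simp: c_step_def)
          moreover have "\<phi> s \<in> states A" using A_D[OF step(1)] by simp
          ultimately have "\<phi> t = \<phi> s"
            using rtrancl_c_step[OF assms(1,2,4)] idem A_D[OF M(2)] by metis
          with t step(2) show ?thesis by (intro skip) auto
        next
          case False
          \<comment> \<open>Thus \<open>\<phi> s\<close> is its own representative, and the image of
            its transition starts at \<open>\<phi> s\<close> in the reduced automaton.\<close>
          have "\<phi> (\<phi> s) = \<phi> s" using A_D[OF M(2)] idem by blast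
          then have "(\<phi> s, a, map_pmf \<phi> \<nu>) \<in> transitions ?B"
            using False step(1) by (auto simp: transitions_reduced_pa_iff[OF assms(1) \<phi>])
          then have "(y, a, map_pmf Inl (map_pmf \<phi> \<nu>)) \<in> transitions D"
            by (auto simp: D_def transitions_disjoint_union Inl p)
          moreover from this have "map_pmf Inl (map_pmf \<phi> \<nu>) \<in> Distr (states D)"
            using D_transition by blast
          ultimately show ?thesis
            using y(1) step(2) A_D[OF step(1)] branching_step_chain[of "\<lambda>_. y" D 0 \<tau> R a]
            by (intro answer[of "map_pmf Inl (map_pmf \<phi> \<nu>)"]) (simp_all add: map_idem)
        qed
      next
        case (Inr t)
        then have t: "t \<in> states A" "\<phi> t = \<phi> s" using y by (auto simp: states_D)
        obtain n where "(t, \<phi> t) \<in> c_step \<tau> c ^^ n"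
          using path[OF t(1)] rtrancl_imp_relpow by blast
        then obtain u where u: "u 0 = t" "u n = \<phi> s" "\<And>i. i < n \<Longrightarrow> (u i, u (Suc i)) \<in> c_step \<tau> c"
          unfolding relpow_fun_conv using t by auto
        \<comment> \<open>Every intermediate state is reached from \<open>t\<close> by
          \<open>c\<close>-steps, so the walk to \<open>\<phi> s\<close> never leaves the class of
          \<open>t\<close>.\<close>
        have u_reach: "(t, u i) \<in> (c_step \<tau> c)\<^sup>*" if "i \<le> n" for i
          using that by (induction i) (use u in \<open>auto intro: rtrancl_into_rtrancl\<close>)
        have "(Inr (u i), \<tau>, return_pmf (Inr (u (Suc i)))) \<in> transitions D" if "i < n" for i
        proof -
          have "(u i, \<tau>, return_pmf (u (Suc i))) \<in> transitions A"
            using u(3)[OF that] assms(2) by (auto simp: c_step_def deterministic_tau_transitions_def)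
          then show ?thesis
            unfolding D_def transitions_disjoint_union by (force simp flip: map_return_pmf)
        qed
        moreover have "(Inr (u 0), Inr (u (Suc i))) \<in> R" if "i < n" for i
          using rtrancl_c_step[OF assms(1,2,4) u_reach[of "Suc i"] t(1)] that t(1) u(1)
          by (auto simp: R_def kernel_on_def states_D)
        moreover have last: "(Inr (u n), a, map_pmf Inr \<nu>) \<in> transitions D"
          using step(1) u(2) by (auto simp: D_def transitions_disjoint_union)
        ultimately have "branching_step \<tau> D R y a (map_pmf Inr \<nu>)"
          using branching_step_chain[of "\<lambda>i. Inr (u i)" D n \<tau> R a] y(1) Inr u(1) by simp
        then show ?thesis
          using D_transition[OF last] step(2) by (intro answer) auto
      qed
    qed
  qed
  then have "branching_bisimulation \<tau> D R"
    unfolding branching_bisimulation_def by (auto simp: R_def equiv_kernel_on)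
  \<comment> \<open>The reduced initial state is \<open>\<phi> (init A)\<close>, so idempotence
    relates it to \<open>init A\<close>.\<close>
  moreover have "(Inl (init ?B), Inr (init A)) \<in> R"
    using assms(1) by (auto simp: R_def kernel_on_def states_D reduced_pa_def idem
        probabilistic_automaton_def)
  ultimately show ?thesis
    unfolding branching_bisimilar_def branching_bisimilar_states_def D_def by blast
qed

end
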